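(* Let $1<\beta<2$, and let $f(z)$ be a function holomorphic in $\mathbb{C}_+$ and continuous in $\overline{\mathbb{C}_+}$ such that for some constant $C>0$ $$|f(z)|\le C e^{|z|^{\beta}},\qquad z\in\mathbb{C}_+,$$ and such that $f(x+iy)\neq 0$ for all $x\in\mathbb{R}$ and $0<y<1$. Then $$\liminf_{|x|\to\infty,\ x\in\mathbb{R}}\frac{\log|f(x+i/2)|}{|x|^{\beta+1}}>-\infty.$$
   Context: $\mathbb{C}_+=\{z\in\mathbb{C}:\mathrm{Im}\, z>0\}$ is the open upper half-plane and $\overline{\mathbb{C}_+}=\{z\in\mathbb{C}:\mathrm{Im}\, z\ge 0\}$. *)

theory Defs
  imports "HOL-Complex_Analysis.Complex_Analysis"
begin

end

theory Submission
  imports Defs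
begin

text \<open>
  The idea: a very negative value of $\log|f|$ at $w = x + i/2$ spreads to a whole disc around $w$,
  because $f$ has no zeros near $w$; and a subharmonic function of moderate growth in the half-plane
  that is very negative on a disc must also be very negative at the fixed point $i/2$, where
  $\log|f|$ is a given finite number. The influence of the disc at $i/2$ is weighted by the
  Green function, of order $|x|^{-2}$, and the growth of $f$ contributes at most $O(|x|^{\beta-1})$ at
  $i/2$. Hence $-\log|f(w)| = O(|x|^{\beta-1} |x|^2) = O(|x|^{\beta+1})$.

  In detail, normalise to $C = 1$ and let $|x| \ge 1$, $A = -\log|f(w)|$ and $M = (|x|+1)^\beta$.
  Harnack's inequality for the positive harmonic function $M - \log|f|$ on the disc of radius $1/2$
  about $w$ gives $\log|f| \le (2M - A)/3$ on the disc of radius $1/4$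
  (lemma \<open>norm_cube_le_of_nonzero\<close>, a form of the Schwarz lemma).

  On the half-disc $\{|z| \le R, \mathrm{Im}\, z > 0\}$ with $R = 4|x|$ the function $|z|^\beta$ is
  majorised by the harmonic function
  $H(z) = K (2 R^{\beta-1} \mathrm{Im}\, z - \mathrm{Re}\, (-iz)^\beta)$, where
  $K = -1/\cos(\beta\pi/2)$ is positive as $1 < \beta < 2$
  (lemma \<open>Re_powr_le_right_halfplane\<close>). The term linear in $R^{\beta-1}$ repairs the wrong sign
  of the other term near the imaginary axis.

  The Green function of the half-plane $\mathrm{Im}\, z > 1/4$ with pole at $w$ is
  $\log|(z - x)/(z - w)|$, since the reflection of $w$ in the line $\mathrm{Im}\, z = 1/4$ is the
  real point $x$. Its integer multiples are logarithms of moduli of holomorphic functions, so the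
  comparison of $\log|f| + n \log|(z-x)/(z-w)|$ with $H$ needs only the maximum modulus principle
  (lemma \<open>norm_le_of_small_on_circle\<close>). It shows that $n \le c\,|x|^{\beta+1}$ whenever
  $6n \le A - 2M$, which bounds $A$.
\<close>

section \<open>Harnack's inequality for zero-free functions\<close>

text \<open>
  With $u = \log B - \log|f| > 0$ harmonic, the claim is Harnack's inequality $u(z) \ge u(w)/3$ on
  the disc of half the radius.
\<close>

lemma norm_cube_le_of_nonzero:
  fixes f :: "complex \<Rightarrow> complex"
  assumes hol: "f holomorphic_on ball w r" and "r > 0"
    and nz: "\<And>z. z \<in> ball w r \<Longrightarrow> f z \<noteq> 0"
    and bd: "\<And>z. z \<in> ball w r \<Longrightarrow> norm (f z) < B"
    and z: "dist w z \<le> r / 2"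
  shows "norm (f z) ^ 3 \<le> B\<^sup>2 * norm (f w)"
proof -
  obtain g where g: "g holomorphic_on ball w r" "\<And>z. z \<in> ball w r \<Longrightarrow> f z = exp (g z)"
    using contractible_imp_holomorphic_log[OF hol _ nz] convex_imp_contractible convex_ball by blast
  have wb: "w \<in> ball w r" and zb: "z \<in> ball w r" using \<open>r > 0\<close> z by auto
  have "B > 0" using bd[OF wb] norm_ge_zero[of "f w"] by linarith
  define q where "q = (\<lambda>z. of_real (ln B) - g z)"
  have Reg: "Re (g u) = ln (norm (f u))" if "u \<in> ball w r" for u
    using g(2)[OF that] by simp
  have Req: "Re (q u) > 0" if "u \<in> ball w r" for u
    using bd[OF that] nz[OF that] \<open>B > 0\<close> by (simp add: q_def Reg[OF that])
  \<comment> \<open>A Moebius transformation maps the right half-plane onto the unit disc and $q(w)$ to $0$.\<close>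
  define p where "p = (\<lambda>s. (q (w + of_real r * s) - q w) / (q (w + of_real r * s) + cnj (q w)))"
  have inb: "w + of_real r * s \<in> ball w r" if "norm s < 1" for s :: complex
    using that \<open>r > 0\<close> by (simp add: dist_norm norm_mult)
  have den: "q u + cnj (q w) \<noteq> 0" if "u \<in> ball w r" for u
    using Req[OF that] Req[OF wb] by (auto simp: complex_eq_iff)
  have "q holomorphic_on ball w r" unfolding q_def by (intro holomorphic_intros g)
  then have "(q \<circ> (\<lambda>s. w + of_real r * s)) holomorphic_on ball 0 1"
    by (intro holomorphic_on_compose_gen[where t = "ball w r"] holomorphic_intros)
       (use inb in auto)
  then have ph: "p holomorphic_on ball 0 1"
    unfolding p_def o_def using den inb by (intro holomorphic_intros) auto
  have p1: "norm (p s) < 1" if s: "norm s < 1" for s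
  proof -
    let ?u = "w + of_real r * s"
    have "(norm (q ?u - q w))\<^sup>2 < (norm (q ?u + cnj (q w)))\<^sup>2"
      using mult_pos_pos[OF Req[OF inb[OF s]] Req[OF wb]]
      unfolding cmod_power2 by (simp add: power2_eq_square algebra_simps)
    then have "norm (q ?u - q w) < norm (q ?u + cnj (q w))"
      by (rule power2_less_imp_less) simp
    then show ?thesis by (simp add: p_def norm_divide den[OF inb[OF s]])
  qed
  define s where "s = (z - w) / of_real r"
  have zs: "w + of_real r * s = z" using \<open>r > 0\<close> by (simp add: s_def)
  have sn: "norm s \<le> 1 / 2"
    using z \<open>r > 0\<close> by (simp add: s_def norm_divide dist_norm norm_minus_commute divide_le_eq)
  have "norm (p s) \<le> norm s"
    using Schwarz_Lemma(1)[OF ph _ p1] sn by (auto simp: p_def)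
  then have "norm (p s) \<le> 1 / 2" using sn by linarith
  then have "norm (q z - q w) \<le> norm (q z + cnj (q w)) / 2"
    using den[OF zb] by (simp add: p_def zs norm_divide divide_le_eq)
  then have "(norm (q z - q w))\<^sup>2 \<le> (norm (q z + cnj (q w)) / 2)\<^sup>2"
    by (rule power_mono) simp
  then have "(Re (q z) - Re (q w))\<^sup>2 \<le> ((Re (q z) + Re (q w)) / 2)\<^sup>2"
    unfolding power_divide cmod_power2
    by (simp add: algebra_simps) (smt (verit) zero_le_power2)
  then have "\<bar>Re (q z) - Re (q w)\<bar> \<le> (Re (q z) + Re (q w)) / 2"
    by (subst (asm) power2_le_iff_abs_le) (use Req[OF zb] Req[OF wb] in simp_all)
  from abs_le_D2[OF this] have "Re (q w) - Re (q z) \<le> (Re (q z) + Re (q w)) / 2" by simp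
  then have "3 * ln (norm (f z)) \<le> 2 * ln B + ln (norm (f w))"
    by (simp add: q_def Reg[OF zb] Reg[OF wb])
  then have "ln (norm (f z) ^ 3) \<le> ln (B\<^sup>2 * norm (f w))"
    using \<open>B > 0\<close> nz[OF wb] nz[OF zb] by (simp add: ln_mult ln_realpow)
  then show ?thesis using \<open>B > 0\<close> nz[OF wb] nz[OF zb] by simp
qed

section \<open>A harmonic majorant of $|z|^\beta$\<close>

text \<open>
  As $\cos(\beta\pi/2) < 0$, this bounds $|\cos(\beta\pi/2)|\,|\zeta|^\beta$ by a harmonic function of
  $\zeta$. In polar coordinates it reduces to
  $\cos\beta\varphi - \cos(\beta\pi/2) \le 2\cos\varphi$ for $\varphi = |\arg\zeta| < \pi/2$.
\<close>
lemma Re_powr_le_right_halfplane: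
  fixes \<beta> R :: real
  assumes "1 < \<beta>" "\<beta> < 2" and "Re \<zeta> > 0" and "norm \<zeta> \<le> R"
  shows "Re (\<zeta> powr of_real \<beta>)
           \<le> cos (\<beta> * pi / 2) * norm \<zeta> powr \<beta> + 2 * R powr (\<beta> - 1) * Re \<zeta>"
proof -
  define r where "r = norm \<zeta>"
  define \<phi> where "\<phi> = \<bar>Arg \<zeta>\<bar>"
  have "\<zeta> \<noteq> 0" using assms(3) by auto
  then have r: "r > 0" by (simp add: r_def)
  have \<phi>: "0 \<le> \<phi>" "\<phi> < pi / 2"
    using Re_Ln_pos_lt[OF \<open>\<zeta> \<noteq> 0\<close>] assms(3) by (auto simp: \<phi>_def Arg_def \<open>\<zeta> \<noteq> 0\<close>)
  have Re: "Re \<zeta> = r * cos \<phi>"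
    using Arg_eq[OF \<open>\<zeta> \<noteq> 0\<close>]
    by (metis \<phi>_def cis_conv_exp cos_abs_real rcis_def Re_rcis r_def)
  have "\<zeta> powr of_real \<beta> = exp (of_real \<beta> * Ln \<zeta>)" using \<open>\<zeta> \<noteq> 0\<close> by (simp add: powr_def)
  then have "Re (\<zeta> powr of_real \<beta>) = exp (\<beta> * ln r) * cos (\<beta> * Arg \<zeta>)"
    using \<open>\<zeta> \<noteq> 0\<close> by (simp add: Re_exp Arg_def r_def)
  also have "cos (\<beta> * Arg \<zeta>) = cos (\<beta> * \<phi>)"
    by (simp add: \<phi>_def abs_if)
  also have "exp (\<beta> * ln r) = r powr \<beta>" using r by (simp add: powr_def)
  finally have pw: "Re (\<zeta> powr of_real \<beta>) = r powr \<beta> * cos (\<beta> * \<phi>)" .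
  define t where "t = \<beta> * (pi / 2 - \<phi>) / 2"
  have t: "0 \<le> t" "t \<le> pi / 2 - \<phi>"
    using \<phi> assms(1,2) mult_right_mono[of \<beta> 2 "pi / 2 - \<phi>"] by (auto simp: t_def)
  have "sin t \<le> sin (pi / 2 - \<phi>)" using t \<phi> by (intro sin_monotone_2pi_le) auto
  then have st: "sin t \<le> cos \<phi>" by (simp add: sin_diff)
  have st0: "0 \<le> sin t" using t \<phi> by (intro sin_ge_zero) auto
  have "cos (\<beta> * \<phi>) - cos (\<beta> * pi / 2) = 2 * sin ((\<beta> * \<phi> + \<beta> * pi / 2) / 2) * sin t"
    by (simp add: cos_diff_cos t_def algebra_simps diff_divide_distrib)
  also have "\<dots> \<le> 2 * 1 * sin t" using st0 by (intro mult_right_mono mult_left_mono) auto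
  finally have c: "cos (\<beta> * \<phi>) \<le> cos (\<beta> * pi / 2) + 2 * cos \<phi>" using st by linarith
  have "r powr \<beta> = r powr (\<beta> - 1) * r" using r by (simp add: powr_mult_base mult.commute)
  moreover have "r powr (\<beta> - 1) \<le> R powr (\<beta> - 1)"
    using assms r by (intro powr_mono2) (auto simp: r_def)
  moreover have "cos \<phi> \<ge> 0" using \<phi> by (intro cos_ge_zero) auto
  ultimately have "r powr \<beta> * cos \<phi> \<le> R powr (\<beta> - 1) * (r * cos \<phi>)"
    using r by (simp add: mult.assoc mult_right_mono)
  then have "r powr \<beta> * (2 * cos \<phi>) \<le> 2 * R powr (\<beta> - 1) * Re \<zeta>" by (simp add: Re)
  moreover have "r powr \<beta> * cos (\<beta> * \<phi>) \<le> r powr \<beta> * (cos (\<beta> * pi / 2) + 2 * cos \<phi>)"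
    by (intro mult_left_mono c) auto
  ultimately show ?thesis unfolding pw by (simp add: algebra_simps r_def)
qed

section \<open>Comparison by the maximum modulus principle\<close>

text \<open>
  Smallness of $f$ on a small circle about $w = x + i/2$ is transported to $i/2$. The number
  $5$ bounds $|(z - x)/(z - w)|$ on the circle, and $n/(16x^2)$ is what the smallness takes off the
  upper bound for $\log|f(i/2)|$. The right-hand side is an upper bound for $\exp H(i/2)$.
\<close>
lemma norm_le_of_small_on_circle:
  fixes f :: "complex \<Rightarrow> complex" and \<beta> x :: real and n :: nat
  assumes \<beta>: "1 < \<beta>" "\<beta> < 2" and x: "1 \<le> \<bar>x\<bar>"
    and hol: "f holomorphic_on {z. Im z > 0}"
    and bd: "\<And>z. Im z > 0 \<Longrightarrow> norm (f z) \<le> exp (norm z powr \<beta>)"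
    and small: "\<And>z. dist (Complex x (1/2)) z = 1/8 \<Longrightarrow> norm (f z) * 5 ^ n \<le> 1"
  shows "norm (f (Complex 0 (1/2))) * exp (real n / (16 * x\<^sup>2))
           \<le> exp ((4 * \<bar>x\<bar>) powr (\<beta> - 1) / (- cos (\<beta> * pi / 2)))"
proof -
  define R where "R = 4 * \<bar>x\<bar>"
  define K where "K = 1 / (- cos (\<beta> * pi / 2))"
  define w where "w = Complex x (1/2)"
  define \<delta> where "\<delta> = real n / (8 * x\<^sup>2)"
  define H where "H = (\<lambda>z. K * (2 * R powr (\<beta> - 1) * Im z - Re ((-\<i> * z) powr of_real \<beta>)))"
  define S where "S = {z. Im z \<ge> 1/4} \<inter> cball 0 R - ball w (1/8)"
  \<comment> \<open>Here $-iz$ has real part $\mathrm{Im}\, z$, so $\mathrm{Re}\, G = -H - \delta (\mathrm{Im}\, z - 1/4)$.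
      The $\delta$-term makes up for the Green function not vanishing on the arc $|z| = R$.\<close>
  define G where "G = (\<lambda>z. of_real K * (-\<i> * z) powr of_real \<beta>
      - of_real (2 * K * R powr (\<beta> - 1)) * (-\<i> * z) - of_real \<delta> * (-\<i> * z - 1/4))"
  define F where "F = (\<lambda>z. f z * ((z - of_real x) / (z - w)) ^ n * exp (G z))"
  have "x \<noteq> 0" using x by auto
  have \<delta>0: "\<delta> \<ge> 0" by (simp add: \<delta>_def)
  have "cos (\<beta> * pi / 2) < 0"
  proof -
    have "cos (\<beta> * pi / 2) < cos (pi / 2)" using \<beta> by (intro cos_monotone_0_pi) auto
    then show ?thesis by simp
  qed
  then have K: "K > 0" "K * cos (\<beta> * pi / 2) = -1" by (auto simp: K_def)
  have H: "norm z powr \<beta> \<le> H z" if "Im z > 0" "norm z \<le> R" for z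
  proof -
    have "K * Re ((-\<i> * z) powr of_real \<beta>)
        \<le> K * (cos (\<beta> * pi / 2) * norm z powr \<beta> + 2 * R powr (\<beta> - 1) * Im z)"
      using Re_powr_le_right_halfplane[OF \<beta>, of "-\<i> * z" R] that K by (simp add: norm_mult)
    also have "\<dots> = (K * cos (\<beta> * pi / 2)) * norm z powr \<beta> + K * (2 * R powr (\<beta> - 1) * Im z)"
      by (simp add: algebra_simps)
    finally show ?thesis unfolding K(2) by (simp add: H_def algebra_simps)
  qed
  have normG: "norm (exp (G z)) = exp (- H z - \<delta> * (Im z - 1/4))" for z
    unfolding norm_exp_eq_Re by (simp add: G_def H_def algebra_simps)
  have normF: "norm (F z) = norm (f z) * norm ((z - of_real x) / (z - w)) ^ n
      * exp (- H z - \<delta> * (Im z - 1/4))" for z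
    by (simp only: F_def norm_mult norm_power normG)
  have quot: "norm ((z - of_real x) / (z - w)) = sqrt (1 + (Im z - 1/4) / (norm (z - w))\<^sup>2)"
    if "z \<noteq> w" for z
  proof -
    have "(norm (z - of_real x))\<^sup>2 = (norm (z - w))\<^sup>2 + (Im z - 1/4)"
      unfolding cmod_power2 by (simp add: w_def power2_eq_square algebra_simps)
    then have "(norm ((z - of_real x) / (z - w)))\<^sup>2 = 1 + (Im z - 1/4) / (norm (z - w))\<^sup>2"
      using that by (simp add: norm_divide power_divide add_divide_distrib)
    then show ?thesis by (metis norm_ge_zero real_sqrt_unique)
  qed
  have holF: "F holomorphic_on ({z. Im z > 0} - {w})"
    unfolding F_def G_def
    by (intro holomorphic_intros holomorphic_on_subset[OF hol])
       (auto simp: complex_nonpos_Reals_iff)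
  have sub: "S \<subseteq> {z. Im z > 0} - {w}" by (auto simp: S_def)
  have clS: "closed S" unfolding S_def
    by (intro closed_Diff closed_Int closed_halfspace_Im_ge) auto
  have bnd: "norm (F z) \<le> 1" if zf: "z \<in> frontier S" for z
  proof -
    have zS: "z \<in> S" using zf clS frontier_subset_closed by blast
    then have zw: "z \<noteq> w" and Imz: "Im z > 0" "Im z \<ge> 1/4" and zR: "norm z \<le> R" using sub
      by (auto simp: S_def)
    have Hz: "norm z powr \<beta> \<le> H z" using H[OF Imz(1) zR] .
    \<comment> \<open>The line, the large arc and the small circle: elsewhere a point of $S$ is interior.\<close>
    consider "Im z = 1/4" | "norm z = R" | "dist w z = 1/8"
    proof -
      define U where "U = {z. Im z > 1/4} \<inter> ball 0 R - cball w (1/8)"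
      have "open U" unfolding U_def
        by (intro open_Diff open_Int open_halfspace_Im_gt) auto
      moreover have "U \<subseteq> S" by (auto simp: S_def U_def)
      ultimately have "U \<subseteq> interior S" by (rule interior_maximal[rotated])
      then have "z \<notin> U" using zf by (auto simp: frontier_def)
      then consider "Im z \<le> 1/4" | "norm z \<ge> R" | "dist w z \<le> 1/8"
        unfolding U_def by force
      then show ?thesis
        using zS that by (cases; force simp: S_def)
    qed
    then show ?thesis
    proof cases
      case 1
      have "norm (F z) = norm (f z) * exp (- H z)"
        by (simp add: normF quot[OF zw] 1 del: norm_divide)
      also have "\<dots> \<le> exp (norm z powr \<beta>) * exp (- H z)"
        by (intro mult_right_mono bd Imz) simp
      also have "\<dots> \<le> 1" using Hz by (simp flip: exp_add)
      finally show ?thesis .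
    next
      case 2
      have "norm w \<le> 2 * \<bar>x\<bar>"
        using cmod_le[of w] x by (simp add: w_def)
      then have "2 * \<bar>x\<bar> \<le> norm (z - w)"
        using norm_triangle_ineq2[of z w] 2 by (simp add: R_def)
      then have "(2 * \<bar>x\<bar>)\<^sup>2 \<le> (norm (z - w))\<^sup>2" by (rule power_mono) simp
      then have "(Im z - 1/4) / (norm (z - w))\<^sup>2 \<le> (Im z - 1/4) / (4 * x\<^sup>2)"
        using Imz \<open>x \<noteq> 0\<close> by (intro divide_left_mono) (auto simp: power_mult_distrib zw)
      then have "1 + (Im z - 1/4) / (norm (z - w))\<^sup>2 \<le> exp ((Im z - 1/4) / (4 * x\<^sup>2))"
        using exp_ge_add_one_self[of "(Im z - 1/4) / (4 * x\<^sup>2)"] by linarith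
      also have "\<dots> = (exp ((Im z - 1/4) / (8 * x\<^sup>2)))\<^sup>2"
        by (simp add: diff_divide_distrib flip: exp_double)
      finally have "norm ((z - of_real x) / (z - w)) \<le> exp ((Im z - 1/4) / (8 * x\<^sup>2))"
        unfolding quot[OF zw] by (intro real_le_lsqrt) (auto simp: Imz)
      then have "norm ((z - of_real x) / (z - w)) ^ n \<le> exp ((Im z - 1/4) / (8 * x\<^sup>2)) ^ n"
        by (rule power_mono) simp
      also have "\<dots> = exp (\<delta> * (Im z - 1/4))"
        by (simp add: \<delta>_def flip: exp_of_nat_mult)
      finally have q: "norm ((z - of_real x) / (z - w)) ^ n \<le> exp (\<delta> * (Im z - 1/4))" .
      have "norm (F z) = norm (f z) * norm ((z - of_real x) / (z - w)) ^ n
          * exp (- H z - \<delta> * (Im z - 1/4))"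
        by (rule normF)
      also have "\<dots> \<le> exp (norm z powr \<beta>) * exp (\<delta> * (Im z - 1/4))
          * exp (- H z - \<delta> * (Im z - 1/4))"
        by (intro mult_right_mono mult_mono bd Imz q) auto
      also have "\<dots> = exp (norm z powr \<beta> - H z)" by (simp flip: exp_add)
      also have "\<dots> \<le> 1" using Hz by simp
      finally show ?thesis .
    next
      case 3
      then have zw8: "norm (z - w) = 1/8" by (simp add: dist_norm norm_minus_commute)
      have "\<bar>Im (z - w)\<bar> \<le> 1/8" using abs_Im_le_cmod[of "z - w"] zw8 by simp
      from abs_le_D1[OF this] have "Im z \<le> 5/8" by (simp add: w_def)
      then have "norm ((z - of_real x) / (z - w)) \<le> 5"
        unfolding quot[OF zw] zw8 by (intro real_le_lsqrt) (auto simp: power2_eq_square)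
      then have q: "norm ((z - of_real x) / (z - w)) ^ n \<le> 5 ^ n" by (rule power_mono) simp
      have "0 \<le> norm z powr \<beta>" by simp
      then have "- H z - \<delta> * (Im z - 1/4) \<le> 0"
        using Hz mult_nonneg_nonneg[OF \<delta>0, of "Im z - 1/4"] Imz by linarith
      then have e: "exp (- H z - \<delta> * (Im z - 1/4)) \<le> 1" by simp
      have "norm (F z) = norm (f z) * norm ((z - of_real x) / (z - w)) ^ n
          * exp (- H z - \<delta> * (Im z - 1/4))"
        by (rule normF)
      also have "\<dots> \<le> norm (f z) * 5 ^ n * 1"
        by (intro mult_mono q e) auto
      also have "\<dots> \<le> 1" using small[of z] 3 by (simp add: w_def)
      finally show ?thesis .
    qed
  qed
  define z0 where "z0 = Complex 0 (1/2)"
  have zw0: "norm (z0 - w) = \<bar>x\<bar>" by (simp add: z0_def w_def cmod_def)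
  have Im0: "Im z0 - 1/4 = 1/4" by (simp add: z0_def)
  have "norm z0 = 1/2" "Im z0 = 1/2" by (simp_all add: z0_def cmod_def)
  then have "z0 \<in> S" using x zw0 by (simp add: S_def R_def dist_norm norm_minus_commute)
  have "norm (F z0) \<le> 1"
  proof (rule maximum_modulus_frontier[of F S])
    show "F holomorphic_on interior S"
      using holF sub interior_subset by (meson holomorphic_on_subset order_trans)
    show "continuous_on (closure S) F"
      using holF sub clS by (metis closure_closed holomorphic_on_imp_continuous_on holomorphic_on_subset)
    show "bounded S" unfolding S_def by (meson Diff_subset Int_lower2 bounded_cball bounded_subset order_trans)
  qed (use bnd \<open>z0 \<in> S\<close> in auto)
  \<comment> \<open>The Green function at $i/2$ is at least $3/(32x^2)$, and the $\delta$-term costs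
      $1/(32x^2)$ for each unit of $n$.\<close>
  have gain: "exp (3 / (32 * x\<^sup>2)) \<le> norm ((z0 - of_real x) / (z0 - w))"
  proof -
    define t where "t = 1 / (16 * x\<^sup>2)"
    have "x\<^sup>2 \<ge> 1" using one_le_power[OF x, of 2] by simp
    then have t: "0 \<le> t" "t \<le> 1/16" by (simp_all add: t_def divide_le_eq)
    have "exp (3 * t) * (1 - 3 * t) \<le> exp (3 * t) * exp (- (3 * t))"
      using exp_ge_add_one_self[of "- (3 * t)"] by (intro mult_left_mono) auto
    also have "\<dots> = 1" by (simp flip: exp_add)
    also have "1 \<le> (1 + 4 * t) * (1 - 3 * t)"
      using mult_left_mono[of t "1/12" t] t by (simp add: algebra_simps)
    finally have "exp (3 * t) \<le> 1 + 4 * t" using t by (simp add: mult_le_cancel_right)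
    moreover have "(exp (3 / (32 * x\<^sup>2)))\<^sup>2 = exp (3 * t)"
      by (simp add: t_def flip: exp_double)
    ultimately have "(exp (3 / (32 * x\<^sup>2)))\<^sup>2 \<le> 1 + 1 / (4 * x\<^sup>2)"
      by (simp add: t_def)
    then have "exp (3 / (32 * x\<^sup>2)) \<le> sqrt (1 + 1 / (4 * x\<^sup>2))" by (rule real_le_rsqrt)
    moreover have "z0 \<noteq> w" using zw0 \<open>x \<noteq> 0\<close> by auto
    then have "norm ((z0 - of_real x) / (z0 - w)) = sqrt (1 + 1 / (4 * x\<^sup>2))"
      using quot[of z0] zw0 by (simp add: Im0 del: norm_divide)
    ultimately show ?thesis by simp
  qed
  have H0: "H z0 \<le> K * R powr (\<beta> - 1)"
  proof -
    have "-\<i> * z0 = of_real (1/2)" by (simp add: z0_def complex_eq_iff)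
    then have "Re ((-\<i> * z0) powr of_real \<beta>) = (1/2) powr \<beta>"
      by (metis Re_complex_of_real half_gt_zero_iff less_eq_real_def powr_of_real zero_less_one)
    then show ?thesis using K unfolding H_def by (simp add: z0_def)
  qed
  have "real n * (3 / (32 * x\<^sup>2)) = real n / (16 * x\<^sup>2) + \<delta> / 4"
    by (simp add: \<delta>_def field_simps)
  then have "exp (real n / (16 * x\<^sup>2) + \<delta> / 4) = exp (3 / (32 * x\<^sup>2)) ^ n"
    by (metis exp_of_nat_mult)
  also have "\<dots> \<le> norm ((z0 - of_real x) / (z0 - w)) ^ n"
    by (intro power_mono gain) simp
  finally have "norm (f z0) * exp (real n / (16 * x\<^sup>2) + \<delta> / 4) * exp (- H z0 - \<delta> / 4)
     \<le> norm (f z0) * norm ((z0 - of_real x) / (z0 - w)) ^ n * exp (- H z0 - \<delta> / 4)"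
    by (intro mult_right_mono mult_left_mono) auto
  also have "\<dots> = norm (F z0)"
    by (simp add: normF Im0)
  also have "\<dots> \<le> 1" by fact
  finally have "norm (f z0) * exp (real n / (16 * x\<^sup>2)) * exp (- H z0) \<le> 1"
    by (simp add: mult.assoc flip: exp_add)
  then have "norm (f z0) * exp (real n / (16 * x\<^sup>2)) \<le> exp (H z0)"
    by (simp add: exp_minus field_simps)
  also have "\<dots> \<le> exp (K * R powr (\<beta> - 1))" using H0 by simp
  finally show ?thesis by (simp add: z0_def K_def R_def)
qed

section \<open>The lower bound\<close>

lemma ln_norm_lower_bound_unit:
  fixes f :: "complex \<Rightarrow> complex" and \<beta> :: real
  assumes \<beta>: "1 < \<beta>" "\<beta> < 2"
    and hol: "f holomorphic_on {z. Im z > 0}"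
    and bd: "\<And>z. Im z > 0 \<Longrightarrow> norm (f z) \<le> exp (norm z powr \<beta>)"
    and nz: "\<And>z. 0 < Im z \<Longrightarrow> Im z < 1 \<Longrightarrow> f z \<noteq> 0"
  obtains B where "\<And>x. 1 \<le> \<bar>x\<bar> \<Longrightarrow>
    - B * \<bar>x\<bar> powr (\<beta> + 1) \<le> ln (norm (f (Complex x (1/2))))"
proof -
  define K where "K = 1 / (- cos (\<beta> * pi / 2))"
  define a where "a = \<bar>ln (norm (f (Complex 0 (1/2))))\<bar>"
  have "cos (\<beta> * pi / 2) < cos (pi / 2)" using \<beta> by (intro cos_monotone_0_pi) auto
  then have K: "K > 0" by (simp add: K_def)
  define B where "B = 6 * (16 * (a + 4 * K)) + 6 + 8"
  have "- B * \<bar>x\<bar> powr (\<beta> + 1) \<le> ln (norm (f (Complex x (1/2))))" if x: "1 \<le> \<bar>x\<bar>" for x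
  proof -
    define w where "w = Complex x (1/2)"
    define M where "M = (\<bar>x\<bar> + 1) powr \<beta>"
    define A where "A = - ln (norm (f w))"
    define P where "P = \<bar>x\<bar> powr (\<beta> + 1)"
    have fw: "f w \<noteq> 0" by (intro nz) (auto simp: w_def)
    have P1: "1 \<le> P" using x \<beta> by (auto simp: P_def intro: ge_one_powr_ge_zero)
    have M: "M \<le> 4 * P"
    proof -
      have "M \<le> (2 * \<bar>x\<bar>) powr \<beta>" unfolding M_def using x \<beta> by (intro powr_mono2) auto
      also have "\<dots> = 2 powr \<beta> * \<bar>x\<bar> powr \<beta>" by (simp add: powr_mult)
      also have "\<dots> \<le> 2 powr 2 * \<bar>x\<bar> powr (\<beta> + 1)"
        using x \<beta> by (intro mult_mono powr_mono) auto
      finally show ?thesis by (simp add: P_def)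
    qed
    have "A \<le> B * P"
    proof (cases "A \<le> 2 * M")
      case True
      have "8 * P \<le> B * P" using K P1 by (intro mult_right_mono) (auto simp: B_def a_def)
      then show ?thesis using True M by linarith
    next
      case False
      \<comment> \<open>The largest $n$ for which Harnack's inequality still yields $|f| 5^n \le 1$ on the circle,
          with $5$ estimated by $e^2$.\<close>
      define y where "y = (A - 2 * M) / 6"
      define n where "n = nat \<lfloor>y\<rfloor>"
      have "real n = of_int \<lfloor>y\<rfloor>" using False by (simp add: n_def y_def)
      then have "real n \<le> y" "y \<le> real n + 1" by linarith+
      then have n: "6 * real n \<le> A - 2 * M" "A - 2 * M \<le> 6 * real n + 6"
        by (simp_all add: y_def)
      have small: "norm (f z) * 5 ^ n \<le> 1" if "dist w z = 1/8" for z
      proof -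
        have half: "ball w (1/2) \<subseteq> {z. 0 < Im z \<and> Im z < 1}"
        proof
          fix u assume "u \<in> ball w (1/2)"
          then have "\<bar>Im (u - w)\<bar> < 1/2"
            by (metis abs_Im_le_cmod dist_norm dist_commute le_less_trans mem_ball)
          then have "\<bar>Im u - 1/2\<bar> < 1/2" by (simp add: w_def)
          then have "0 < Im u" "Im u < 1" by (simp_all only: abs_less_iff) linarith+
          then show "u \<in> {z. 0 < Im z \<and> Im z < 1}" by simp
        qed
        have "norm (f z) ^ 3 \<le> (exp M)\<^sup>2 * norm (f w)"
        proof (rule norm_cube_le_of_nonzero[of f w "1/2" "exp M" z])
          show "f holomorphic_on ball w (1/2)" using half by (intro holomorphic_on_subset[OF hol]) auto
        next
          fix u assume u: "u \<in> ball w (1/2)"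
          then have Im: "0 < Im u" "Im u < 1" using half by auto
          show "f u \<noteq> 0" by (rule nz[OF Im])
          have "norm w \<le> \<bar>x\<bar> + 1/2" using cmod_le[of w] by (simp add: w_def)
          then have "norm u < \<bar>x\<bar> + 1"
            using u norm_triangle_sub[of u w] by (simp add: dist_norm norm_minus_commute)
          then have "norm u powr \<beta> < M" unfolding M_def using \<beta> by (intro powr_less_mono2) auto
          then show "norm (f u) < exp M" using bd[OF Im(1)] by (meson exp_less_cancel_iff le_less_trans)
        qed (use that in auto)
        also have "norm (f w) = exp (- A)" using fw by (simp add: A_def)
        also have "(exp M)\<^sup>2 * exp (- A) = exp (2 * M - A)"
          by (simp flip: exp_double exp_add)
        finally have f3: "norm (f z) ^ 3 \<le> exp (2 * M - A)" .
        have "(5::real) \<le> (1 + 1 + 1/2)\<^sup>2" by (simp add: power2_eq_square)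
        also have "\<dots> \<le> (exp 1)\<^sup>2"
          using exp_lower_Taylor_quadratic[of "1::real"] by (intro power_mono) auto
        finally have "(5::real) \<le> exp 2" by (simp flip: exp_double)
        then have "(5::real) ^ (3 * n) \<le> exp 2 ^ (3 * n)" by (rule power_mono) simp
        also have "\<dots> = exp (6 * real n)" by (simp flip: exp_of_nat_mult)
        finally have "(norm (f z) * 5 ^ n) ^ 3 \<le> exp (2 * M - A) * exp (6 * real n)"
          unfolding power_mult_distrib using f3
          by (intro mult_mono) (auto simp: mult.commute simp flip: power_mult)
        also have "\<dots> \<le> 1" using n by (simp flip: exp_add)
        finally show ?thesis using power_mono_iff[of "norm (f z) * 5 ^ n" 1 3] by simp
      qed
      have "norm (f (Complex 0 (1/2))) * exp (real n / (16 * x\<^sup>2)) \<le> exp (K * (4 * \<bar>x\<bar>) powr (\<beta> - 1))"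
        using norm_le_of_small_on_circle[OF \<beta> x hol bd small] by (simp add: w_def K_def)
      moreover have f0: "f (Complex 0 (1/2)) \<noteq> 0" by (intro nz) auto
      ultimately have "ln (norm (f (Complex 0 (1/2))) * exp (real n / (16 * x\<^sup>2)))
          \<le> ln (exp (K * (4 * \<bar>x\<bar>) powr (\<beta> - 1)))"
        by (subst ln_le_cancel_iff) auto
      then have "real n / (16 * x\<^sup>2) \<le> a + K * (4 * \<bar>x\<bar>) powr (\<beta> - 1)"
        using f0 by (simp add: ln_mult a_def)
      moreover have "K * (4 * \<bar>x\<bar>) powr (\<beta> - 1) \<le> K * (4 * \<bar>x\<bar> powr (\<beta> - 1))"
      proof -
        have "4 powr (\<beta> - 1) \<le> (4::real) powr 1" using \<beta> by (intro powr_mono) auto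
        then show ?thesis using K by (simp add: powr_mult mult_right_mono)
      qed
      moreover have "a * 1 \<le> a * \<bar>x\<bar> powr (\<beta> - 1)"
        using x \<beta> by (intro mult_left_mono ge_one_powr_ge_zero) (auto simp: a_def)
      ultimately have "real n / (16 * x\<^sup>2) \<le> (a + 4 * K) * \<bar>x\<bar> powr (\<beta> - 1)"
        unfolding distrib_right by linarith
      moreover have "16 * x\<^sup>2 > 0" using x by (auto simp: zero_less_power2)
      ultimately have "real n \<le> (a + 4 * K) * \<bar>x\<bar> powr (\<beta> - 1) * (16 * x\<^sup>2)"
        by (simp only: pos_divide_le_eq)
      also have "\<dots> = 16 * (a + 4 * K) * (\<bar>x\<bar> powr (\<beta> - 1) * x\<^sup>2)"
        by (simp only: mult_ac)
      also have "\<bar>x\<bar> powr (\<beta> - 1) * x\<^sup>2 = P"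
      proof -
        have "\<bar>x\<bar> powr 2 = x\<^sup>2" using x by (simp add: powr_numeral)
        moreover have "P = \<bar>x\<bar> powr (\<beta> - 1) * \<bar>x\<bar> powr 2"
          unfolding P_def powr_add[symmetric] by (simp add: add.commute)
        ultimately show ?thesis by simp
      qed
      finally have "real n \<le> 16 * (a + 4 * K) * P" .
      then have "A \<le> 6 * (16 * (a + 4 * K) * P) + 6 * P + 8 * P" using n M P1 by linarith
      then show ?thesis by (simp add: B_def algebra_simps)
    qed
    then show ?thesis by (simp add: A_def P_def w_def)
  qed
  then show thesis using that by blast
qed

theorem proposition2p4:
  fixes f :: "complex \<Rightarrow> complex" and \<beta> C :: real
  assumes "1 < \<beta>" and "\<beta> < 2"
    and "f holomorphic_on {z. Im z > 0}"
    and "continuous_on {z. Im z \<ge> 0} f"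
    and "C > 0"
    and "\<And>z. Im z > 0 \<Longrightarrow> norm (f z) \<le> C * exp (norm z powr \<beta>)"
    and "\<And>x y. 0 < y \<Longrightarrow> y < 1 \<Longrightarrow> f (Complex x y) \<noteq> 0"
  shows "Liminf at_infinity
           (\<lambda>x::real. ereal (ln (norm (f (Complex x (1/2)))) / \<bar>x\<bar> powr (\<beta> + 1))) > -\<infinity>"
proof -
  obtain B where B: "\<And>x. 1 \<le> \<bar>x\<bar> \<Longrightarrow>
      - B * \<bar>x\<bar> powr (\<beta> + 1) \<le> ln (norm (f (Complex x (1/2)) / of_real C))"
  proof (rule ln_norm_lower_bound_unit[of \<beta> "\<lambda>z. f z / of_real C"])
    show "(\<lambda>z. f z / of_real C) holomorphic_on {z. Im z > 0}"
      using \<open>C > 0\<close> by (intro holomorphic_intros assms) auto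
    show "norm (f z / of_real C) \<le> exp (norm z powr \<beta>)" if "Im z > 0" for z
      using assms(6)[OF that] \<open>C > 0\<close> by (simp add: norm_divide divide_le_eq mult.commute)
    show "f z / of_real C \<noteq> 0" if "0 < Im z" "Im z < 1" for z
      using assms(7)[OF that, of "Re z"] \<open>C > 0\<close> by simp
  qed (use assms in auto)
  have "ereal (- B - \<bar>ln C\<bar>) \<le> ereal (ln (norm (f (Complex x (1/2)))) / \<bar>x\<bar> powr (\<beta> + 1))"
    if x: "1 \<le> \<bar>x\<bar>" for x
  proof -
    have P1: "1 \<le> \<bar>x\<bar> powr (\<beta> + 1)" using x assms(1) by (auto intro: ge_one_powr_ge_zero)
    have "f (Complex x (1/2)) \<noteq> 0" by (intro assms) auto
    then have "- B * \<bar>x\<bar> powr (\<beta> + 1) - \<bar>ln C\<bar> \<le> ln (norm (f (Complex x (1/2))))"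
      using B[OF x] \<open>C > 0\<close> by (simp add: norm_divide ln_div)
    moreover have "\<bar>ln C\<bar> \<le> \<bar>ln C\<bar> * \<bar>x\<bar> powr (\<beta> + 1)"
      using mult_left_mono[OF P1, of "\<bar>ln C\<bar>"] by simp
    ultimately have "(- B - \<bar>ln C\<bar>) * \<bar>x\<bar> powr (\<beta> + 1) \<le> ln (norm (f (Complex x (1/2))))"
      by (simp add: algebra_simps)
    then show ?thesis using x by (auto simp: le_divide_eq)
  qed
  then have "ereal (- B - \<bar>ln C\<bar>) \<le> Liminf at_infinity
      (\<lambda>x::real. ereal (ln (norm (f (Complex x (1/2)))) / \<bar>x\<bar> powr (\<beta> + 1)))"
    by (intro Liminf_bounded) (auto simp: eventually_at_infinity intro!: exI[of _ 1])
  then show ?thesis by (rule less_le_trans[rotated]) simp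
qed

end
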